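(* Let $X$ be a quasinormed space equipped with the quasinorm $\lVert\cdot\rVert_X$ and denote by $C_X$ its modulus of concavity. Then the following statements are equivalent: (1) $X$ is complete. (2) $X$ has the generalised Riesz--Fischer property with some constant $C\in[1,\infty)$. (3) $X$ has the generalised Riesz--Fischer property with constant $C_X$. (4) $X$ has the generalised Riesz--Fischer property with every constant $C\in(1,\infty)$. (5) $X$ has the strong generalised Riesz--Fischer property.
   Context: Here $0\in\mathbb N$. A quasinorm on a complex linear space $X$ is a functional $\lVert\cdot\rVert_X:X\to[0,\infty)$ such that $\lVert ax\rVert_X=|a|\lVert x\rVert_X$ for all $a\in\mathbb C$, $x\in X$; $\lVert x\rVert_X=0$ if and only if $x=0$; and there is a constant $C_X\ge 1$, called the modulus of concavity of $\lVert\cdot\rVert_X$, such that $\lVert x+y\rVert_X\le C_X(\lVert x\rVert_X+\lVert y\rVert_X)$ for all $x,y\in X$. A quasinorm induces a metrisable topology on $X$ in which $x_n\to x$ if and only if $\lVert x_n-x\rVert_X\to0$. $X$ is complete if every sequence that is Cauchy with respect to $\lVert\cdot\rVert_X$ converges to some $x\in X$. For $C\in[1,\infty)$, $X$ has the generalised Riesz--Fischer property with constant $C$ if for every sequence $(x_n)_{n\in\mathbb N}$ in $X$ with $\sum_{n=0}^\infty C^{n+1}\lVert x_n\rVert_X<\infty$ there is $x\in X$ such that $\lim_{N\to\infty}\sum_{n=0}^N x_n=x$ in the quasinormed topology of $X$. $X$ has the strong generalised Riesz--Fischer property if for every sequence $(x_n)_{n\in\mathbb N}$ in $X$ for which there exists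 a constant $\widetilde C\in(1,\infty)$ with $\sum_{n=0}^\infty \widetilde C^{\,n+1}\lVert x_n\rVert_X<\infty$ there is $x\in X$ such that $\lim_{N\to\infty}\sum_{n=0}^N x_n=x$ in the quasinormed topology of $X$. *)

theory Defs
  imports "HOL-Analysis.Abstract_Limits"
begin

text \<open>Any constant admissible in the quasi-triangle inequality counts as a modulus of concavity;
  it is not required to be the least one.\<close>

definition modulus_of_concavity :: "('a::ab_group_add \<Rightarrow> real) \<Rightarrow> real \<Rightarrow> bool" where
  "modulus_of_concavity q C \<longleftrightarrow> C \<ge> 1 \<and> (\<forall>x y. q (x + y) \<le> C * (q x + q y))"

locale quasinormed_space = vector_space scale
  for scale :: "complex \<Rightarrow> 'a::ab_group_add \<Rightarrow> 'a" +
  fixes qnorm :: "'a \<Rightarrow> real"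
  assumes qnorm_nonneg: "qnorm x \<ge> 0"
    and qnorm_scale: "qnorm (scale a x) = cmod a * qnorm x"
    and qnorm_eq_0_iff: "qnorm x = 0 \<longleftrightarrow> x = 0"
    and ex_modulus_of_concavity: "\<exists>C. modulus_of_concavity qnorm C"

text \<open>Quasinorm balls need not be open in this topology, but they are neighbourhoods of their
  centres; see the lemma on limits below.\<close>

definition quasinorm_topology :: "('a::ab_group_add \<Rightarrow> real) \<Rightarrow> 'a topology" where
  "quasinorm_topology q =
     topology (\<lambda>U. \<forall>x\<in>U. \<exists>e>0. \<forall>y. q (y - x) < e \<longrightarrow> y \<in> U)"

definition quasinorm_Cauchy :: "('a::ab_group_add \<Rightarrow> real) \<Rightarrow> (nat \<Rightarrow> 'a) \<Rightarrow> bool" where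
  "quasinorm_Cauchy q x \<longleftrightarrow> (\<forall>e>0. \<exists>M. \<forall>m\<ge>M. \<forall>n\<ge>M. q (x m - x n) < e)"

definition quasinorm_complete :: "('a::ab_group_add \<Rightarrow> real) \<Rightarrow> bool" where
  "quasinorm_complete q \<longleftrightarrow>
     (\<forall>x. quasinorm_Cauchy q x \<longrightarrow> (\<exists>l. limitin (quasinorm_topology q) x l sequentially))"

definition generalised_Riesz_Fischer :: "('a::ab_group_add \<Rightarrow> real) \<Rightarrow> real \<Rightarrow> bool" where
  "generalised_Riesz_Fischer q C \<longleftrightarrow>
     (\<forall>x :: nat \<Rightarrow> 'a. summable (\<lambda>n. C ^ (n + 1) * q (x n)) \<longrightarrow>
        (\<exists>l. limitin (quasinorm_topology q) (\<lambda>N. \<Sum>n=0..N. x n) l sequentially))"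

definition strong_generalised_Riesz_Fischer :: "('a::ab_group_add \<Rightarrow> real) \<Rightarrow> bool" where
  "strong_generalised_Riesz_Fischer q \<longleftrightarrow>
     (\<forall>x :: nat \<Rightarrow> 'a. (\<exists>C>1. summable (\<lambda>n. C ^ (n + 1) * q (x n))) \<longrightarrow>
        (\<exists>l. limitin (quasinorm_topology q) (\<lambda>N. \<Sum>n=0..N. x n) l sequentially))"

lemma openin_quasinorm_topology:
  "openin (quasinorm_topology q) U \<longleftrightarrow> (\<forall>x\<in>U. \<exists>e>0. \<forall>y. q (y - x) < e \<longrightarrow> y \<in> U)"
proof -
  have "istopology (\<lambda>U. \<forall>x\<in>U. \<exists>e>0. \<forall>y. q (y - x) < e \<longrightarrow> y \<in> U)"
    unfolding istopology_def
  proof (rule conjI; intro allI impI)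
    fix S T
    assume S: "\<forall>x\<in>S. \<exists>e>0. \<forall>y. q (y - x) < e \<longrightarrow> y \<in> S"
      and T: "\<forall>x\<in>T. \<exists>e>0. \<forall>y. q (y - x) < e \<longrightarrow> y \<in> T"
    show "\<forall>x\<in>S \<inter> T. \<exists>e>0. \<forall>y. q (y - x) < e \<longrightarrow> y \<in> S \<inter> T"
    proof
      fix x assume "x \<in> S \<inter> T"
      then obtain d e where "d > 0" "\<forall>y. q (y - x) < d \<longrightarrow> y \<in> S"
        and "e > 0" "\<forall>y. q (y - x) < e \<longrightarrow> y \<in> T"
        using S T by blast
      then show "\<exists>e>0. \<forall>y. q (y - x) < e \<longrightarrow> y \<in> S \<inter> T"
        by (intro exI[of _ "min d e"]) auto
    qed
  next
    fix K
    assume K: "\<forall>S\<in>K. \<forall>x\<in>S. \<exists>e>0. \<forall>y. q (y - x) < e \<longrightarrow> y \<in> S"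
    show "\<forall>x\<in>\<Union>K. \<exists>e>0. \<forall>y. q (y - x) < e \<longrightarrow> y \<in> \<Union>K"
      using K by (meson UnionE UnionI)
  qed
  then show ?thesis
    by (simp add: quasinorm_topology_def topology_inverse')
qed

lemma topspace_quasinorm_topology [simp]: "topspace (quasinorm_topology q) = UNIV"
proof -
  have "openin (quasinorm_topology q) UNIV"
    by (auto simp: openin_quasinorm_topology intro: exI[of _ 1])
  then show ?thesis
    using openin_subset by blast
qed

lemma (in quasinormed_space) limitin_quasinorm_topology:
  "limitin (quasinorm_topology qnorm) x l sequentially \<longleftrightarrow> (\<lambda>n. qnorm (x n - l)) \<longlonglongrightarrow> 0"
proof
  assume lim: "limitin (quasinorm_topology qnorm) x l sequentially"
  obtain C where C: "C \<ge> 1" "\<And>x y. qnorm (x + y) \<le> C * (qnorm x + qnorm y)"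
    using ex_modulus_of_concavity unfolding modulus_of_concavity_def by blast
  have q0: "qnorm 0 = 0"
    by (simp add: qnorm_eq_0_iff)
  have "\<forall>\<^sub>F n in sequentially. qnorm (x n - l) < e" if "e > 0" for e
  proof -
    define V where "V = {z. \<exists>d>0. \<forall>y. qnorm (y - z) < d \<longrightarrow> qnorm (y - l) < e}"
    have "openin (quasinorm_topology qnorm) V"
      unfolding openin_quasinorm_topology
    proof
      fix z assume "z \<in> V"
      then obtain d where d: "d > 0" "\<And>y. qnorm (y - z) < d \<Longrightarrow> qnorm (y - l) < e"
        unfolding V_def by blast
      define r where "r = d / (2 * C)"
      have "r > 0"
        using d(1) C(1) by (simp add: r_def)
      have "w \<in> V" if w: "qnorm (w - z) < r" for w
      proof -
        have "qnorm (y - l) < e" if y: "qnorm (y - w) < r" for y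
        proof (rule d(2))
          have "qnorm (y - z) \<le> C * (qnorm (y - w) + qnorm (w - z))"
            using C(2)[of "y - w" "w - z"] by simp
          also have "\<dots> < C * (r + r)"
            using w y C(1) by (intro mult_strict_left_mono) auto
          also have "\<dots> = d"
            using C(1) by (simp add: r_def)
          finally show "qnorm (y - z) < d" .
        qed
        then show ?thesis
          using \<open>r > 0\<close> unfolding V_def by blast
      qed
      then show "\<exists>e>0. \<forall>y. qnorm (y - z) < e \<longrightarrow> y \<in> V"
        using \<open>r > 0\<close> by blast
    qed
    moreover have "l \<in> V"
      using \<open>e > 0\<close> unfolding V_def by blast
    ultimately have "\<forall>\<^sub>F n in sequentially. x n \<in> V"
      using lim by (simp add: limitin_def)
    moreover have "qnorm (z - l) < e" if "z \<in> V" for z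
      using that q0 unfolding V_def by fastforce
    ultimately show ?thesis
      by (auto elim: eventually_mono)
  qed
  then show "(\<lambda>n. qnorm (x n - l)) \<longlonglongrightarrow> 0"
    by (intro tendstoI) (simp add: qnorm_nonneg)
next
  assume lim: "(\<lambda>n. qnorm (x n - l)) \<longlonglongrightarrow> 0"
  show "limitin (quasinorm_topology qnorm) x l sequentially"
    unfolding limitin_def
  proof (intro conjI allI impI)
    fix U assume U: "openin (quasinorm_topology qnorm) U \<and> l \<in> U"
    then obtain e where e: "e > 0" "\<And>y. qnorm (y - l) < e \<Longrightarrow> y \<in> U"
      unfolding openin_quasinorm_topology by blast
    have "\<forall>\<^sub>F n in sequentially. qnorm (x n - l) < e"
      using lim e(1) by (rule order_tendstoD(2))
    then show "\<forall>\<^sub>F n in sequentially. x n \<in> U"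
      by eventually_elim (rule e(2))
  qed simp
qed

end

theory Submission
  imports Defs
begin

text \<open>If the terms of a series decay geometrically with ratio \<open>1 / D\<close>, cut it into blocks of
  \<open>p\<close> terms with \<open>D ^ p\<close> at least twice the modulus of concavity: the factor lost in splitting off a
  block is then absorbed by the decay from one block to the next. Hence the partial sums are Cauchy
  for every \<open>D > 1\<close>. Conversely, every Cauchy sequence has a subsequence whose increments are
  summable against any prescribed weights.\<close>

lemma modulus_of_concavity_ge_1: "modulus_of_concavity q C \<Longrightarrow> C \<ge> 1"
  by (simp add: modulus_of_concavity_def)

lemma modulus_of_concavity_triangle:
  "modulus_of_concavity q C \<Longrightarrow> q (x + y) \<le> C * (q x + q y)"
  by (simp add: modulus_of_concavity_def)

context quasinormed_space
begin

lemma qnorm_minus: "qnorm (- x) = qnorm x"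
  using qnorm_scale[of "- 1" x] by simp

lemma qnorm_0 [simp]: "qnorm 0 = 0"
  by (simp add: qnorm_eq_0_iff)

lemma qnorm_minus_commute: "qnorm (x - y) = qnorm (y - x)"
  using qnorm_minus[of "x - y"] by simp

lemma qnorm_diff_triangle:
  assumes "modulus_of_concavity qnorm C"
  shows "qnorm (x - z) \<le> C * (qnorm (x - y) + qnorm (y - z))"
  using modulus_of_concavity_triangle[OF assms, of "x - y" "y - z"] by simp

text \<open>Peeling off the first term costs one factor \<open>C\<close> on everything that remains,
  so the term with index \<open>i\<close> collects \<open>i + 1\<close> of them. These are exactly
  the weights of the generalised Riesz-Fischer property with constant \<open>C\<close>.\<close>

lemma qnorm_sum_le:
  assumes "modulus_of_concavity qnorm C"
  shows "qnorm (\<Sum>i<N. x i) \<le> (\<Sum>i<N. C ^ (i + 1) * qnorm (x i))"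
proof (induction N arbitrary: x)
  case (Suc N)
  have "C \<ge> 1"
    by (rule modulus_of_concavity_ge_1[OF assms])
  have "qnorm (\<Sum>i<Suc N. x i) \<le> C * (qnorm (x 0) + qnorm (\<Sum>i<N. x (Suc i)))"
    using modulus_of_concavity_triangle[OF assms] by (simp add: sum.lessThan_Suc_shift del: sum.lessThan_Suc)
  also have "\<dots> \<le> C * (qnorm (x 0) + (\<Sum>i<N. C ^ (i + 1) * qnorm (x (Suc i))))"
    using Suc.IH[of "\<lambda>i. x (Suc i)"] \<open>C \<ge> 1\<close> by (intro mult_left_mono add_left_mono) auto
  also have "\<dots> = (\<Sum>i<Suc N. C ^ (i + 1) * qnorm (x i))"
    unfolding sum.lessThan_Suc_shift by (simp add: sum_distrib_left algebra_simps)
  finally show ?case .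
qed simp

text \<open>\<open>B\<close> is fixed before the sequence, the starting index and the number of
  terms, so the right-hand side decays geometrically in \<open>m\<close>, uniformly in
  \<open>N\<close>.\<close>

lemma qnorm_sum_le_geometric:
  assumes "modulus_of_concavity qnorm C" and "D > 1"
  obtains B where "\<And>x M m N. M \<ge> 0 \<Longrightarrow> (\<And>n. D ^ n * qnorm (x n) \<le> M) \<Longrightarrow>
    qnorm (\<Sum>i<N. x (m + i)) \<le> B * M / D ^ m"
proof -
  have "C \<ge> 1"
    by (rule modulus_of_concavity_ge_1[OF assms(1)])
  obtain p where p: "2 * C < D ^ p"
    using real_arch_pow[OF assms(2)] by blast
  have "p > 0"
    using p \<open>C \<ge> 1\<close> by (cases p) auto
  \<comment> \<open>The cost of one block: at most \<open>p\<close> summands, each weighted by at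
    most \<open>C ^ p\<close>.\<close>
  define A where "A = real p * C ^ p"
  have "A \<ge> 0"
    using \<open>C \<ge> 1\<close> by (simp add: A_def)
  \<comment> \<open>The constant \<open>2 * C * A\<close> reproduces itself under splitting: in
    units of \<open>M / D ^ m\<close>, the first block and the remainder contribute at most
    \<open>A\<close> each, and the split multiplies their sum by \<open>C\<close>.\<close>
  have "qnorm (\<Sum>i<N. x (m + i)) \<le> (2 * C * A) * M / D ^ m"
    if M: "M \<ge> 0" "\<And>n. D ^ n * qnorm (x n) \<le> M" for x :: "nat \<Rightarrow> 'a" and M m N
  proof (induction N arbitrary: m rule: less_induct)
    case (less N)
    have block: "qnorm (\<Sum>i<k. x (m + i)) \<le> A * M / D ^ m" if "k \<le> p" for k
    proof -
      have "C ^ (i + 1) * qnorm (x (m + i)) \<le> C ^ p * (M / D ^ m)" if "i < k" for i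
      proof (rule mult_mono)
        show "C ^ (i + 1) \<le> C ^ p"
          using that \<open>k \<le> p\<close> \<open>C \<ge> 1\<close> by (intro power_increasing) auto
        have "D ^ m * qnorm (x (m + i)) \<le> D ^ (m + i) * qnorm (x (m + i))"
          using assms(2) by (intro mult_right_mono power_increasing qnorm_nonneg) auto
        also have "\<dots> \<le> M"
          by (rule M(2))
        finally show "qnorm (x (m + i)) \<le> M / D ^ m"
          using assms(2) by (simp add: field_simps)
      qed (use \<open>C \<ge> 1\<close> qnorm_nonneg in auto)
      then have "(\<Sum>i<k. C ^ (i + 1) * qnorm (x (m + i))) \<le> real k * (C ^ p * (M / D ^ m))"
        using sum_bounded_above[of "{..<k}" "\<lambda>i. C ^ (i + 1) * qnorm (x (m + i))"
            "C ^ p * (M / D ^ m)"]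
        by (simp del: power_Suc add_Suc_right)
      also have "\<dots> \<le> real p * (C ^ p * (M / D ^ m))"
        using that \<open>C \<ge> 1\<close> M(1) assms(2) by (intro mult_right_mono) auto
      finally show ?thesis
        using qnorm_sum_le[OF assms(1), of "\<lambda>i. x (m + i)" k] by (simp add: A_def)
    qed
    have pos: "A * M / D ^ m \<ge> 0"
      using \<open>A \<ge> 0\<close> M(1) assms(2) by simp
    show ?case
    proof (cases "N \<le> p")
      case True
      have "1 * (A * M / D ^ m) \<le> (2 * C) * (A * M / D ^ m)"
        using pos \<open>C \<ge> 1\<close> by (intro mult_right_mono) auto
      then show ?thesis
        using block[OF True] by (simp add: mult.assoc)
    next
      case False
      have "(\<Sum>i<p + k. x (m + i)) = (\<Sum>i<p. x (m + i)) + (\<Sum>i<k. x (m + p + i))" for k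
        by (induction k) (simp_all add: add.assoc)
      from this[of "N - p"]
      have "(\<Sum>i<N. x (m + i)) = (\<Sum>i<p. x (m + i)) + (\<Sum>i<N - p. x (m + p + i))"
        using False by simp
      then have "qnorm (\<Sum>i<N. x (m + i)) \<le>
          C * (qnorm (\<Sum>i<p. x (m + i)) + qnorm (\<Sum>i<N - p. x (m + p + i)))"
        using modulus_of_concavity_triangle[OF assms(1)] by simp
      also have "\<dots> \<le> C * (A * M / D ^ m + (2 * C * A) * M / D ^ (m + p))"
        using block[of p] less.IH[of "N - p" "m + p"] False \<open>p > 0\<close> \<open>C \<ge> 1\<close>
        by (intro mult_left_mono add_mono) auto
      \<comment> \<open>The remainder starts \<open>p\<close> indices later; by the choice of
        \<open>p\<close>, the gained factor \<open>1 / D ^ p\<close> offsets the surplus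
        \<open>2 * C\<close> of the induction hypothesis.\<close>
      also have "(2 * C * A) * M / D ^ (m + p) = (A * M / D ^ m) * (2 * C / D ^ p)"
        by (simp add: power_add)
      also have "\<dots> \<le> (A * M / D ^ m) * 1"
        using p pos assms(2) by (intro mult_left_mono) auto
      finally show ?thesis
        using \<open>C \<ge> 1\<close> by (simp add: algebra_simps)
    qed
  qed
  then show thesis
    by (rule that)
qed

text \<open>Common core of both implications out of completeness: when blocks of any length are
  controlled by a null sequence in their starting index, the partial sums are Cauchy.\<close>

lemma complete_imp_convergent_series:
  assumes complete: "quasinorm_complete qnorm"
    and bound: "\<And>m k. qnorm (\<Sum>i<k. x (m + i)) \<le> g m" and "g \<longlonglongrightarrow> 0"
  shows "\<exists>l. limitin (quasinorm_topology qnorm) (\<lambda>N. \<Sum>n=0..N. x n) l sequentially"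
proof -
  define S where "S = (\<lambda>N. \<Sum>n=0..N. x n)"
  \<comment> \<open>\<open>S m\<close> already contains the term with index \<open>m\<close>, so the
    difference is a block starting at \<open>Suc m\<close>.\<close>
  have le: "qnorm (S n - S m) \<le> g (Suc m)" if "m \<le> n" for m n
  proof -
    have "S (m + k) - S m = (\<Sum>i<k. x (Suc m + i))" for k
    proof (induction k)
      case (Suc k)
      have "S (m + Suc k) - S m = (S (m + k) - S m) + x (Suc m + k)"
        by (simp add: S_def)
      then show ?case
        using Suc.IH by simp
    qed simp
    from this[of "n - m"] that have "S n - S m = (\<Sum>i<n - m. x (Suc m + i))"
      by simp
    then show ?thesis
      using bound by presburger
  qed
  have "quasinorm_Cauchy qnorm S"
    unfolding quasinorm_Cauchy_def
  proof (intro allI impI)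
    fix e :: real assume "e > 0"
    then obtain M where M: "\<And>n. n \<ge> M \<Longrightarrow> g n < e"
      using order_tendstoD(2)[OF \<open>g \<longlonglongrightarrow> 0\<close>] unfolding eventually_sequentially by blast
    have "qnorm (S m - S n) < e" if "m \<ge> M" "n \<ge> M" for m n
    proof (cases "n \<le> m")
      case True
      then show ?thesis
        using le[of n m] M[of "Suc n"] that by simp
    next
      case False
      then show ?thesis
        using le[of m n] M[of "Suc m"] that by (simp add: qnorm_minus_commute[of "S m"])
    qed
    then show "\<exists>M. \<forall>m\<ge>M. \<forall>n\<ge>M. qnorm (S m - S n) < e"
      by blast
  qed
  then show ?thesis
    using complete by (simp add: quasinorm_complete_def S_def)
qed

text \<open>The tails of the weighted series serve as the null sequence. This is not a case of the
  strong property, since \<open>C\<close> may be 1.\<close>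

lemma complete_imp_generalised_Riesz_Fischer:
  assumes "modulus_of_concavity qnorm C" and "quasinorm_complete qnorm"
  shows "generalised_Riesz_Fischer qnorm C"
  unfolding generalised_Riesz_Fischer_def
proof (intro allI impI)
  fix x :: "nat \<Rightarrow> 'a"
  let ?f = "\<lambda>n. C ^ (n + 1) * qnorm (x n)"
  assume sm: "summable ?f"
  have "C \<ge> 1"
    by (rule modulus_of_concavity_ge_1[OF assms(1)])
  then have nonneg: "?f n \<ge> 0" for n
    by (simp add: qnorm_nonneg)
  show "\<exists>l. limitin (quasinorm_topology qnorm) (\<lambda>N. \<Sum>n=0..N. x n) l sequentially"
  proof (rule complete_imp_convergent_series[OF assms(2)])
    fix m k
    have "qnorm (\<Sum>i<k. x (m + i)) \<le> (\<Sum>i<k. C ^ (i + 1) * qnorm (x (m + i)))"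
      by (rule qnorm_sum_le[OF assms(1)])
    \<comment> \<open>As \<open>C\<close> is at least 1, raising the exponent by \<open>m\<close>
      only enlarges the sum, and turns it into a piece of the given series.\<close>
    also have "\<dots> \<le> (\<Sum>i<k. ?f (i + m))"
      using \<open>C \<ge> 1\<close> unfolding add.commute[of m]
      by (intro sum_mono mult_right_mono power_increasing qnorm_nonneg) auto
    also have "\<dots> \<le> (\<Sum>i. ?f (i + m))"
      using sm nonneg by (intro sum_le_suminf summable_ignore_initial_segment) auto
    finally show "qnorm (\<Sum>i<k. x (m + i)) \<le> (\<Sum>i. ?f (i + m))" .
  next
    show "(\<lambda>m. \<Sum>i. ?f (i + m)) \<longlonglongrightarrow> 0"
      using suminf_exist_split[OF _ sm] by (intro LIMSEQ_I) auto
  qed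
qed

text \<open>Summability bounds the weighted terms, which is geometric decay of the terms;
  \<open>qnorm_sum_le_geometric\<close> passes this decay on to blocks, even when \<open>D\<close>
  is below the modulus of concavity.\<close>

lemma complete_imp_strong_generalised_Riesz_Fischer:
  assumes "quasinorm_complete qnorm"
  shows "strong_generalised_Riesz_Fischer qnorm"
  unfolding strong_generalised_Riesz_Fischer_def
proof (intro allI impI, elim exE conjE)
  fix x :: "nat \<Rightarrow> 'a" and D :: real
  assume D: "D > 1" and sm: "summable (\<lambda>n. D ^ (n + 1) * qnorm (x n))"
  obtain C where C: "modulus_of_concavity qnorm C"
    using ex_modulus_of_concavity by blast
  obtain B where B: "\<And>x M m N. M \<ge> 0 \<Longrightarrow> (\<And>n. D ^ n * qnorm (x n) \<le> M) \<Longrightarrow>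
      qnorm (\<Sum>i<N. x (m + i)) \<le> B * M / D ^ m"
    using qnorm_sum_le_geometric[OF C D] by blast
  obtain M where M: "\<And>n. norm (D ^ (n + 1) * qnorm (x n)) \<le> M"
    using summable_imp_Bseq[OF sm] unfolding Bseq_def by blast
  have "M \<ge> 0"
    using M[of 0] norm_ge_zero order_trans by blast
  have "D ^ n * qnorm (x n) \<le> M" for n
  proof -
    have "D ^ n * qnorm (x n) \<le> D ^ (n + 1) * qnorm (x n)"
      using D by (intro mult_right_mono power_increasing qnorm_nonneg) auto
    then show ?thesis
      using M[of n] by simp
  qed
  then have "qnorm (\<Sum>i<k. x (m + i)) \<le> B * M / D ^ m" for m k
    using B \<open>M \<ge> 0\<close> by blast
  moreover have "(\<lambda>m. B * M / D ^ m) \<longlonglongrightarrow> 0"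
    using D by (rule LIMSEQ_divide_realpow_zero)
  ultimately show "\<exists>l. limitin (quasinorm_topology qnorm) (\<lambda>N. \<Sum>n=0..N. x n) l sequentially"
    by (rule complete_imp_convergent_series[OF assms, where g = "\<lambda>m. B * M / D ^ m"])
qed

text \<open>The increments of a fast subsequence form a series to which the property applies.
  Telescoping gives a limit of the subsequence, and the Cauchy condition carries it over to the
  whole sequence.\<close>

lemma generalised_Riesz_Fischer_imp_complete:
  assumes RF: "generalised_Riesz_Fischer qnorm C" and "C \<ge> 1"
  shows "quasinorm_complete qnorm"
  unfolding quasinorm_complete_def
proof (intro allI impI)
  fix x assume x: "quasinorm_Cauchy qnorm x"
  \<comment> \<open>The part \<open>C ^ (k + 1)\<close> of the denominator cancels the weight,
    leaving a convergent geometric series of ratio 1/2.\<close>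
  define a where "a = (\<lambda>k :: nat. (1 / (2 * C)) ^ (k + 1))"
  have "\<forall>k. \<exists>M. \<forall>m\<ge>M. \<forall>n\<ge>M. qnorm (x m - x n) < a k"
    using x \<open>C \<ge> 1\<close> by (simp add: quasinorm_Cauchy_def a_def)
  then obtain M where M: "\<And>k m n. m \<ge> M k \<Longrightarrow> n \<ge> M k \<Longrightarrow> qnorm (x m - x n) < a k"
    by metis
  \<comment> \<open>Cumulative sums put both \<open>r k\<close> and \<open>r (Suc k)\<close> at or
    above \<open>M k\<close>, so the increment between them is below \<open>a k\<close>.\<close>
  define r where "r = (\<lambda>k. \<Sum>j\<le>k. M j)"
  have r: "r k \<ge> M k" "r (Suc k) \<ge> M k" for k
    unfolding r_def by (rule member_le_sum; simp)+
  define y where "y = (\<lambda>k. x (r (Suc k)) - x (r k))"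
  have le: "norm (C ^ (k + 1) * qnorm (y k)) \<le> (1 / 2) ^ (k + 1)" for k
  proof -
    have "C ^ (k + 1) * qnorm (y k) \<le> C ^ (k + 1) * a k"
      using M[OF r(2) r(1)] \<open>C \<ge> 1\<close> unfolding y_def
      by (intro mult_left_mono less_imp_le) simp_all
    also have "\<dots> = (1 / 2) ^ (k + 1)"
      using \<open>C \<ge> 1\<close> by (simp add: a_def power_divide power_mult_distrib)
    finally show ?thesis
      using \<open>C \<ge> 1\<close> by (simp add: qnorm_nonneg)
  qed
  have "summable (\<lambda>k. (1 / 2 :: real) ^ (k + 1))"
    by (rule summable_ignore_initial_segment[OF summable_geometric]) simp
  then have "summable (\<lambda>k. C ^ (k + 1) * qnorm (y k))"
    by (rule summable_comparison_test') (rule le)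
  then obtain l where "limitin (quasinorm_topology qnorm) (\<lambda>N. \<Sum>n=0..N. y n) l sequentially"
    using RF unfolding generalised_Riesz_Fischer_def by blast
  moreover have "(\<Sum>n=0..N. y n) = x (r (Suc N)) - x (r 0)" for N
    unfolding y_def by (rule sum_Suc_diff) simp
  \<comment> \<open>The telescoped sum lacks the starting value, so the candidate limit is
    \<open>l\<close> shifted by \<open>x (r 0)\<close>.\<close>
  ultimately have sub: "(\<lambda>N. qnorm (x (r (Suc N)) - (l + x (r 0)))) \<longlonglongrightarrow> 0"
    by (simp add: limitin_quasinorm_topology algebra_simps)
  \<comment> \<open>\<open>C\<close> need not be a modulus of concavity, so the triangle estimate
    takes a constant of its own.\<close>
  obtain K where K: "modulus_of_concavity qnorm K"
    using ex_modulus_of_concavity by blast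
  then have "K \<ge> 1"
    by (rule modulus_of_concavity_ge_1)
  have a: "a \<longlonglongrightarrow> 0"
    unfolding a_def
    by (rule LIMSEQ_ignore_initial_segment[OF LIMSEQ_realpow_zero]) (use \<open>C \<ge> 1\<close> in auto)
  have "(\<lambda>n. qnorm (x n - (l + x (r 0)))) \<longlonglongrightarrow> 0"
  proof (rule order_tendstoI)
    fix e :: real assume "e > 0"
    have "(\<lambda>k. K * (a k + qnorm (x (r (Suc k)) - (l + x (r 0))))) \<longlonglongrightarrow> K * (0 + 0)"
      by (intro tendsto_intros a sub)
    then have "\<forall>\<^sub>F k in sequentially. K * (a k + qnorm (x (r (Suc k)) - (l + x (r 0)))) < e"
      using \<open>e > 0\<close> by (intro order_tendstoD(2)) auto
    then obtain k where k: "K * (a k + qnorm (x (r (Suc k)) - (l + x (r 0)))) < e"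
      using eventually_happens by fastforce
    \<comment> \<open>One good \<open>k\<close> suffices: \<open>n\<close> and
      \<open>r (Suc k)\<close> are both at least \<open>M k\<close>, so \<open>x n\<close> is within
      \<open>a k\<close> of a point already close to the limit.\<close>
    have "qnorm (x n - (l + x (r 0))) < e" if "n \<ge> M k" for n
    proof -
      have "qnorm (x n - (l + x (r 0))) \<le>
          K * (qnorm (x n - x (r (Suc k))) + qnorm (x (r (Suc k)) - (l + x (r 0))))"
        by (rule qnorm_diff_triangle[OF K])
      also have "\<dots> \<le> K * (a k + qnorm (x (r (Suc k)) - (l + x (r 0))))"
        using M[OF that r(2)] \<open>K \<ge> 1\<close> by (intro mult_left_mono) auto
      finally show ?thesis
        using k by simp
    qed
    then show "\<forall>\<^sub>F n in sequentially. qnorm (x n - (l + x (r 0))) < e"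
      by (rule eventually_sequentiallyI)
  next
    fix e :: real assume "e < 0"
    then show "\<forall>\<^sub>F n in sequentially. e < qnorm (x n - (l + x (r 0)))"
      by (intro always_eventually allI less_le_trans[OF _ qnorm_nonneg])
  qed
  then show "\<exists>l. limitin (quasinorm_topology qnorm) x l sequentially"
    unfolding limitin_quasinorm_topology by (rule exI)
qed

end

lemma strong_imp_generalised_Riesz_Fischer:
  "strong_generalised_Riesz_Fischer q \<Longrightarrow> C > 1 \<Longrightarrow> generalised_Riesz_Fischer q C"
  unfolding strong_generalised_Riesz_Fischer_def generalised_Riesz_Fischer_def by blast

theorem theorem3p3:
  fixes scale :: "complex \<Rightarrow> 'a::ab_group_add \<Rightarrow> 'a"
    and qnorm :: "'a \<Rightarrow> real"
    and C\<^sub>X :: real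
  assumes "quasinormed_space scale qnorm"
    and "modulus_of_concavity qnorm C\<^sub>X"
  shows "(quasinorm_complete qnorm \<longleftrightarrow> (\<exists>C\<ge>1. generalised_Riesz_Fischer qnorm C)) \<and>
    (quasinorm_complete qnorm \<longleftrightarrow> generalised_Riesz_Fischer qnorm C\<^sub>X) \<and>
    (quasinorm_complete qnorm \<longleftrightarrow> (\<forall>C>1. generalised_Riesz_Fischer qnorm C)) \<and>
    (quasinorm_complete qnorm \<longleftrightarrow> strong_generalised_Riesz_Fischer qnorm)"
proof -
  interpret quasinormed_space scale qnorm
    by (rule assms(1))
  have "C\<^sub>X \<ge> 1"
    by (rule modulus_of_concavity_ge_1[OF assms(2)])
  \<comment> \<open>Every way back to completeness uses the property for just one constant at least
    1; the instance 2 below is an arbitrary choice.\<close>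
  have RF_imp: "quasinorm_complete qnorm" if "generalised_Riesz_Fischer qnorm C" "C \<ge> 1" for C
    using that by (rule generalised_Riesz_Fischer_imp_complete)
  have all_imp: "quasinorm_complete qnorm" if "\<forall>C>1. generalised_Riesz_Fischer qnorm C"
    using that RF_imp[of 2] by simp
  show ?thesis
  proof (intro conjI iffI)
    show "\<exists>C\<ge>1. generalised_Riesz_Fischer qnorm C" if "quasinorm_complete qnorm"
      using complete_imp_generalised_Riesz_Fischer[OF assms(2) that] \<open>C\<^sub>X \<ge> 1\<close> by blast
    show "\<forall>C>1. generalised_Riesz_Fischer qnorm C" if "quasinorm_complete qnorm"
      using complete_imp_strong_generalised_Riesz_Fischer[OF that]
      by (blast intro: strong_imp_generalised_Riesz_Fischer)
    show "quasinorm_complete qnorm" if "strong_generalised_Riesz_Fischer qnorm"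
      using that all_imp by (blast intro: strong_imp_generalised_Riesz_Fischer)
    show "generalised_Riesz_Fischer qnorm C\<^sub>X" if "quasinorm_complete qnorm"
      by (rule complete_imp_generalised_Riesz_Fischer[OF assms(2) that])
    show "strong_generalised_Riesz_Fischer qnorm" if "quasinorm_complete qnorm"
      by (rule complete_imp_strong_generalised_Riesz_Fischer[OF that])
  qed (use RF_imp all_imp \<open>C\<^sub>X \<ge> 1\<close> in blast)+
qed

end
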